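(* Let $y,q$ be indeterminates and define $\lambda_n=(1+q^ny)(1+q^ny^{-1})$ for odd $n\ge1$ and $\lambda_n=(1-q^n)^2$ for even $n\ge 2$. Then, as formal power series in $z$, \[ \sum_{k=0}^{\infty}z^k\sum_{j=-k}^{k}y^jq^{k(k+1)-j^2} =\cfrac{1}{1+z-\cfrac{\lambda_1 z}{1+z-\cfrac{\lambda_2 z}{1+z-\cfrac{\lambda_3 z}{1+z-\cdots}}}}. \]
   Context: The infinite continued fraction (a "T-fraction") is understood as a formal power series in $z$, the limit of its finite truncations in the $z$-adic topology. *)

theory Defs
  imports "HOL-Computational_Algebra.Computational_Algebra"
begin

text \<open>
  Coefficients live in \<open>Frac(\<int>[q][y]) = \<rat>(q, y)\<close>, which contains the ring
  \<open>\<int>[q, y, y\<^sup>-\<^sup>1]\<close>; the indeterminate \<open>z\<close> is \<^const>\<open>fps_X\<close>.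
\<close>

type_synonym rat_fun_qy = "int poly poly fract"

definition y_ind :: rat_fun_qy where
  "y_ind = Fract [:0, 1:] 1"

definition q_ind :: rat_fun_qy where
  "q_ind = Fract [:[:0, 1:]:] 1"

text \<open>Only the values at \<open>n \<ge> 1\<close> are meaningful.\<close>

definition lam :: "'a::field \<Rightarrow> 'a \<Rightarrow> nat \<Rightarrow> 'a" where
  "lam y q n =
     (if odd n then (1 + q ^ n * y) * (1 + q ^ n * inverse y) else (1 - q ^ n)\<^sup>2)"

text \<open>
  \<open>T_convergent c m n\<close> is
  \<open>1 / (1 + z - c\<^sub>m z / (1 + z - c\<^sub>m\<^sub>+\<^sub>1 z / (\<dots> - c\<^sub>m\<^sub>+\<^sub>n\<^sub>-\<^sub>1 z / (1 + z))))\<close>,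
  the truncation after \<open>n\<close> partial numerators of the T-fraction starting at \<open>c\<^sub>m\<close>. All
  denominators have constant term 1, so the divisions are by units.
\<close>

fun T_convergent :: "(nat \<Rightarrow> 'a::field) \<Rightarrow> nat \<Rightarrow> nat \<Rightarrow> 'a fps" where
  "T_convergent c m 0 = 1 / (1 + fps_X)"
| "T_convergent c m (Suc n) =
     1 / (1 + fps_X - fps_const (c m) * fps_X * T_convergent c (Suc m) n)"

text \<open>
  The topology on \<^typ>\<open>'a fps\<close> is the \<open>z\<close>-adic one, whatever the coefficient type.
\<close>

definition T_fraction_has_value :: "(nat \<Rightarrow> 'a::field) \<Rightarrow> 'a fps \<Rightarrow> bool" where
  "T_fraction_has_value c F \<longleftrightarrow> (\<lambda>n. T_convergent c 1 n) \<longlonglongrightarrow> F"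

end

theory Submission
  imports Defs
begin

text \<open>
  Put \<open>p = q\<^sup>2\<close> and extend the coefficients \<open>f\<^sub>k\<close> of the left-hand side to \<open>k \<in> \<int>\<close> by
  \<open>f\<^bsub>-1-k\<^esub> = - f\<^sub>k\<close>; then \<open>f\<^sub>k - p\<^sup>k f\<^bsub>k-1\<^esub> = (q y)\<^sup>k + (q / y)\<^sup>k\<close> for all \<open>k\<close>. Let \<open>M\<close>
  be the linear functional \<open>w\<^sup>k \<mapsto> f\<^sub>k\<close> on Laurent polynomials. The recurrence says
  \<open>M (h(w) - h(p w) / w) = h(q y) + h(q / y)\<close>, and choosing
  \<open>h = \<Prod>i<n. (1 + p\<^sup>i w) (1 + p\<^bsup>i+1\<^esup> / w)\<close> yields
  \<open>M (\<Prod>i<n. (1 + p\<^sup>i w) (1 + p\<^sup>i / w)) = \<lambda>\<^sub>1 \<lambda>\<^sub>3 \<cdots> \<lambda>\<^bsub>2n-1\<^esub>\<close>. Newton interpolation of the kernel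
  \<open>1 / (1 - w z)\<close> in this basis gives
  \<open>\<Sum>k. f\<^sub>k z\<^sup>k = \<Sum>k. \<lambda>\<^sub>1 \<lambda>\<^sub>3 \<cdots> \<lambda>\<^bsub>2k-1\<^esub> K\<^sub>k(z)\<close> with
  \<open>K\<^sub>k = p\<^sup>k z\<^sup>k (1 + z) / \<Prod>i\<le>k. (1 + p\<^sup>i z) (p\<^sup>i + z)\<close>. Inserting factors \<open>\<Prod>i<n. (p\<^sup>k - p\<^sup>i)\<close> into
  the coefficients of this series produces an explicit solution of the recurrence
  \<open>G\<^bsub>m-1\<^esub> = (1 + z) G\<^sub>m - \<lambda>\<^sub>m z G\<^bsub>m+1\<^esub>\<close> with \<open>G\<^sub>0 = 1\<close>, and the T-fraction then has the value \<open>G\<^sub>1\<close>.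
\<close>

section \<open>T-fractions from three-term recurrences\<close>

text \<open>The quotients \<open>G (Suc m) / G m\<close> obey the same one-step relation as the
  tails of the T-fraction, and each further level multiplies the error by z.\<close>

lemma T_fraction_has_valueI:
  fixes G :: "nat \<Rightarrow> 'a::field fps"
  assumes G_0: "G 0 = 1"
    and rec: "\<And>m. G m = (1 + fps_X) * G (Suc m) - fps_const (c (Suc m)) * fps_X * G (Suc (Suc m))"
  shows "T_fraction_has_value c (G 1)"
proof -
  have G_nth_0: "G m $ 0 = 1" for m
  proof (induction m)
    case (Suc m)
    then show ?case
      using arg_cong[OF rec[of m], of "\<lambda>F. F $ 0"] by simp
  qed (simp add: G_0)
  have approx: "fps_X ^ Suc n dvd T_convergent c (Suc m) n * G m - G (Suc m)" for m n
  proof (induction n arbitrary: m)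
    case 0
    define D :: "'a fps" where "D = 1 + fps_X"
    have "inverse D * D = 1"
      by (rule inverse_mult_eq_1) (simp add: D_def)
    then have "inverse D * G m - G (Suc m) = inverse D * (G m - D * G (Suc m))"
      by (simp add: right_diff_distrib flip: mult.assoc)
    also have "G m - D * G (Suc m) = fps_X * (- (fps_const (c (Suc m)) * G (Suc (Suc m))))"
      by (subst rec) (simp add: D_def algebra_simps)
    finally show ?case
      by (simp add: fps_divide_unit D_def)
  next
    case (Suc n)
    define A where "A = T_convergent c (Suc (Suc m)) n"
    define D where "D = 1 + fps_X - fps_const (c (Suc m)) * fps_X * A"
    have "inverse D * D = 1"
      by (rule inverse_mult_eq_1) (simp add: D_def)
    then have "inverse D * G m - G (Suc m) = inverse D * (G m - D * G (Suc m))"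
      by (simp add: right_diff_distrib flip: mult.assoc)
    also have "G m - D * G (Suc m) =
        fps_const (c (Suc m)) * (fps_X * (A * G (Suc m) - G (Suc (Suc m))))"
      by (subst rec) (simp add: D_def algebra_simps)
    finally show ?case
      using Suc.IH[of "Suc m"] by (simp add: fps_divide_unit D_def A_def)
  qed
  show ?thesis
    unfolding T_fraction_has_value_def
  proof (rule tendsto_fpsI)
    fix j
    have "T_convergent c 1 n $ j = G 1 $ j" if "n \<ge> j" for n
    proof -
      obtain R where "T_convergent c 1 n - G 1 = fps_X ^ Suc n * R"
        using approx[of n 0] by (auto simp: G_0 elim: dvdE)
      then show ?thesis
        using that fps_X_power_mult_nth[of "Suc n" R j] fps_sub_nth[of "T_convergent c 1 n" "G 1" j]
        by (simp del: fps_sub_nth power_Suc)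
    qed
    then show "\<forall>\<^sub>F n in sequentially. T_convergent c 1 n $ j = G 1 $ j"
      by (auto simp: eventually_sequentially)
  qed
qed

section \<open>The bilateral extension of the coefficient sequence\<close>

definition theta_coeff :: "'a::field \<Rightarrow> 'a \<Rightarrow> nat \<Rightarrow> 'a" where
  "theta_coeff y q k = (\<Sum>j = - int k..int k. y powi j * q powi (int k * (int k + 1) - j\<^sup>2))"

definition bil_coeff :: "'a::field \<Rightarrow> 'a \<Rightarrow> int \<Rightarrow> 'a" where
  "bil_coeff y q k = (if k \<ge> 0 then theta_coeff y q (nat k) else - theta_coeff y q (nat (- 1 - k)))"

lemma bil_coeff_antisym: "bil_coeff y q (- 1 - k) = - bil_coeff y q k"
  by (auto simp: bil_coeff_def)

lemma theta_coeff_0 [simp]: "theta_coeff y q 0 = 1"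
  by (simp add: theta_coeff_def)

text \<open>The old terms gain the factor \<open>q ^ (2 * Suc k)\<close>; the new indices j = k + 1
  and j = -(k + 1) contribute the two powers.\<close>

lemma theta_coeff_Suc:
  fixes q y :: "'a::field"
  assumes "q \<noteq> 0" "y \<noteq> 0"
  shows "theta_coeff y q (Suc k) = (q\<^sup>2) ^ Suc k * theta_coeff y q k + (q * y) ^ Suc k + (q / y) ^ Suc k"
proof -
  let ?t = "\<lambda>k j. y powi j * q powi (k * (k + 1) - j\<^sup>2)"
  have "{- int (Suc k)..int (Suc k)} = insert (int (Suc k)) (insert (- int (Suc k)) {- int k..int k})"
    by auto
  then have "theta_coeff y q (Suc k) = ?t (int (Suc k)) (int (Suc k)) + ?t (int (Suc k)) (- int (Suc k))
      + (\<Sum>j = - int k..int k. ?t (int (Suc k)) j)"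
    by (simp add: theta_coeff_def add.assoc)
  moreover have "?t (int (Suc k)) j = (q\<^sup>2) ^ Suc k * ?t (int k) j" for j
  proof -
    have "int (Suc k) * (int (Suc k) + 1) - j\<^sup>2 = int (2 * Suc k) + (int k * (int k + 1) - j\<^sup>2)"
      by (simp add: algebra_simps)
    then have "q powi (int (Suc k) * (int (Suc k) + 1) - j\<^sup>2) =
        (q\<^sup>2) ^ Suc k * q powi (int k * (int k + 1) - j\<^sup>2)"
      using assms by (simp only: power_int_add power_int_of_nat power_mult simp_thms)
    then show ?thesis by (simp only: mult.left_commute)
  qed
  moreover have "int (Suc k) * (int (Suc k) + 1) - (int (Suc k))\<^sup>2 = int (Suc k)"
    by (simp add: algebra_simps power2_eq_square)
  ultimately have "theta_coeff y q (Suc k) = y ^ Suc k * q ^ Suc k + inverse (y ^ Suc k) * q ^ Suc k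
      + (q\<^sup>2) ^ Suc k * (\<Sum>j = - int k..int k. ?t (int k) j)"
    by (simp only: power2_minus power_int_of_nat power_int_minus sum_distrib_left)
  then show ?thesis
    unfolding theta_coeff_def[of y q k]
    by (simp only: power_mult_distrib power_divide) (simp add: field_simps)
qed

lemma bil_coeff_diff:
  fixes q y :: "'a::field"
  assumes "q \<noteq> 0" "y \<noteq> 0"
  shows "bil_coeff y q k - (q\<^sup>2) powi k * bil_coeff y q (k - 1) = (q * y) powi k + (q / y) powi k"
proof -
  consider "k = 0" | n where "k = int (Suc n)" | n where "k = - int (Suc n)"
    by (metis int_cases nat.exhaust of_nat_0)
  then show ?thesis
  proof cases
    case 1
    then show ?thesis by (simp add: bil_coeff_def)
  next
    case 2
    then have "bil_coeff y q k = theta_coeff y q (Suc n)" "bil_coeff y q (k - 1) = theta_coeff y q n"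
      by (simp_all add: bil_coeff_def nat_add_distrib)
    then show ?thesis
      unfolding 2 by (simp only: theta_coeff_Suc[OF assms] power_int_of_nat add_diff_cancel_left' add.assoc)
  next
    case 3
    then have "bil_coeff y q k = - theta_coeff y q n" "bil_coeff y q (k - 1) = - theta_coeff y q (Suc n)"
      by (simp_all add: bil_coeff_def nat_add_distrib)
    \<comment> \<open>With u = (q y)^(n+1) and v = (q / y)^(n+1), the recurrence at index n + 1 has
      the coefficient u v; dividing it by u v gives the reflected case.\<close>
    moreover have "(q\<^sup>2) ^ Suc n = (q * y) ^ Suc n * (q / y) ^ Suc n"
      using assms by (simp add: power2_eq_square flip: power_mult_distrib)
    moreover have "(q * y) ^ Suc n \<noteq> 0" "(q / y) ^ Suc n \<noteq> 0"
      using assms by simp_all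
    moreover have "- t + inverse (u * v) * (u * v * t + u + v) = inverse u + inverse v"
      if "u \<noteq> 0" "v \<noteq> 0" for t u v :: 'a
      using that by (simp add: field_simps)
    ultimately show ?thesis
      unfolding 3
      by (simp only: theta_coeff_Suc[OF assms] power_int_of_nat power_int_minus mult_minus_right
          diff_minus_eq_add)
  qed
qed

section \<open>Shift operators\<close>

text \<open>If \<open>s k\<close> is M(w^k g), then \<open>fwd c s\<close> and
  \<open>bwd c s\<close> replace g by (1 + c w) g and (1 + c / w) g.\<close>

definition fwd :: "'a::comm_ring_1 \<Rightarrow> (int \<Rightarrow> 'a) \<Rightarrow> int \<Rightarrow> 'a" where
  "fwd c s k = s k + c * s (k + 1)"

definition bwd :: "'a::comm_ring_1 \<Rightarrow> (int \<Rightarrow> 'a) \<Rightarrow> int \<Rightarrow> 'a" where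
  "bwd c s k = s k + c * s (k - 1)"

text \<open>
  With \<open>E\<close> the forward shift, \<open>shift_prod p a b n\<close> is
  \<open>\<Prod>i<n. (1 + p\<^sup>a\<^sup>+\<^sup>i E) (1 + p\<^sup>b\<^sup>+\<^sup>i E\<^sup>-\<^sup>1)\<close>.
\<close>

primrec shift_prod :: "'a::comm_ring_1 \<Rightarrow> nat \<Rightarrow> nat \<Rightarrow> nat \<Rightarrow> (int \<Rightarrow> 'a) \<Rightarrow> int \<Rightarrow> 'a" where
  "shift_prod p a b 0 s = s"
| "shift_prod p a b (Suc n) s = fwd (p ^ (a + n)) (bwd (p ^ (b + n)) (shift_prod p a b n s))"

lemma fwd_commute: "fwd c (fwd d s) = fwd d (fwd c s)"
  by (simp add: fwd_def fun_eq_iff algebra_simps)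

lemma bwd_commute: "bwd c (bwd d s) = bwd d (bwd c s)"
  by (simp add: bwd_def fun_eq_iff algebra_simps)

lemma fwd_bwd_commute: "fwd c (bwd d s) = bwd d (fwd c s)"
  by (simp add: fwd_def bwd_def fun_eq_iff algebra_simps)

lemmas shift_commute = fwd_commute bwd_commute fwd_bwd_commute

text \<open>This and the next two lemmas pull the outer factors off a common core, which reduces
  \<open>shift_prod_diff\<close> to an identity between those factors.\<close>

lemma shift_prod_01: "shift_prod p 0 1 (Suc n) s = fwd 1 (bwd (p ^ Suc n) (shift_prod p 1 1 n s))"
proof (induction n)
  case (Suc n)
  show ?case
    by (subst shift_prod.simps, subst Suc) (simp add: shift_commute)
qed simp

lemma shift_prod_10: "shift_prod p 1 0 (Suc n) s = fwd (p ^ Suc n) (bwd 1 (shift_prod p 1 1 n s))"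
proof (induction n)
  case (Suc n)
  show ?case
    by (subst shift_prod.simps, subst Suc) (simp add: shift_commute)
qed simp

lemma shift_prod_00: "shift_prod p 0 0 (Suc n) s = fwd 1 (bwd 1 (shift_prod p 1 1 n s))"
proof (induction n)
  case (Suc n)
  show ?case
    by (subst shift_prod.simps, subst Suc) (simp add: shift_commute)
qed simp

text \<open>With c = p^n, the terms containing c cancel in (1 + E)(1 + c/E) - (1 + c E)(1 + 1/E)/E,
  leaving (1 - 1/E)(1 + E)(1 + 1/E).\<close>

lemma shift_prod_diff:
  "shift_prod p 0 1 n s k - shift_prod p 1 0 n s (k - 1) =
   shift_prod p 0 0 n s k - shift_prod p 0 0 n s (k - 1)"
proof (cases n)
  case (Suc m)
  then show ?thesis
    by (simp only: shift_prod_01 shift_prod_10 shift_prod_00) (simp add: fwd_def bwd_def algebra_simps)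
qed simp

lemma shift_prod_linear:
  "shift_prod p a b n (\<lambda>k. s k + c * t k) k = shift_prod p a b n s k + c * shift_prod p a b n t k"
  by (induction n arbitrary: k) (simp_all add: fwd_def bwd_def algebra_simps)

lemma shift_prod_powi:
  fixes p x :: "'a::field"
  assumes "x \<noteq> 0"
  shows "shift_prod p a b n (\<lambda>k. x powi k) k =
    (\<Prod>i<n. (1 + p ^ (a + i) * x) * (1 + p ^ (b + i) / x)) * x powi k"
proof (induction n arbitrary: k)
  case (Suc n)
  have "x powi (k + 1) = x powi k * x" "x powi (k - 1) = x powi k / x" for k
    using assms by (simp_all add: power_int_add_1 power_int_diff)
  then show ?case
    using assms by (simp add: fwd_def bwd_def Suc) (simp add: field_simps)
qed simp

text \<open>Conjugation by \<open>p powi k\<close> turns E into p E, which is the substitution of p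
  w for w under M.\<close>

lemma shift_prod_twist:
  fixes p :: "'a::field"
  assumes "p \<noteq> 0"
  shows "shift_prod p 0 1 n (\<lambda>k. p powi k * s (k - 1)) k = p powi k * shift_prod p 1 0 n s (k - 1)"
proof (induction n arbitrary: k)
  case (Suc n)
  have "p powi (k + 1) = p powi k * p" "p powi (k - 1) = p powi k / p"
    using assms by (simp_all add: power_int_add_1 power_int_diff)
  then show ?case
    using assms by (simp add: fwd_def bwd_def Suc[unfolded One_nat_def]) (simp add: field_simps)
qed simp

text \<open>The reflection of k to -1 - k exchanges E and 1/E, and equal starting exponents make the
  product symmetric in the two.\<close>

lemma shift_prod_antisym:
  assumes "\<And>k. s (- 1 - k) = - s k"
  shows "shift_prod p a a n s (- 1 - k) = - shift_prod p a a n s k"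
proof (induction n arbitrary: k)
  case (Suc n)
  have "shift_prod p a a n s (- k) = - shift_prod p a a n s (k - 1)"
    "shift_prod p a a n s (- 2 - k) = - shift_prod p a a n s (k + 1)"
    using Suc[of "k - 1"] Suc[of "k + 1"] by simp_all
  moreover have "- 1 - k - 1 = - 2 - k" "- 1 - k + 1 = - k" "- k - 1 = - 1 - k"
    by simp_all
  ultimately have "shift_prod p a a (Suc n) s (- 1 - k) =
      - shift_prod p a a n s k + p ^ (a + n) * - shift_prod p a a n s (k + 1)
      + p ^ (a + n) * (- shift_prod p a a n s (k - 1) + p ^ (a + n) * - shift_prod p a a n s k)"
    using Suc[of k] by (simp only: fwd_def bwd_def shift_prod.simps)
  then show ?case
    by (simp add: fwd_def bwd_def algebra_simps)
qed (simp add: assms)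

section \<open>A kernel expansion of the generating function\<close>

lemma fps_X_power_dvdI:
  fixes f :: "'a::comm_ring_1 fps"
  assumes "\<And>j. j < n \<Longrightarrow> f $ j = 0"
  shows "fps_X ^ n dvd f"
proof
  show "f = fps_X ^ n * fps_shift n f"
    by (rule fps_ext) (simp add: fps_X_power_mult_nth assms)
qed

lemma fps_X_power_mult_shift:
  fixes f :: "'a::comm_ring_1 fps"
  assumes "fps_X ^ n dvd f"
  shows "fps_X ^ n * fps_shift n f = f"
  using assms by (auto simp: fps_eq_iff fps_X_power_mult_nth elim!: dvdE)

lemma fps_eqI_dvd:
  fixes f g :: "'a::comm_ring_1 fps"
  assumes "\<And>n. fps_X ^ Suc n dvd f - g"
  shows "f = g"
proof (rule fps_ext)
  fix n
  obtain h where "f - g = fps_X ^ Suc n * h"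
    using assms[of n] by (elim dvdE)
  then have "(f - g) $ n = 0"
    by (simp only: fps_X_power_mult_nth) simp
  then show "f $ n = g $ n" by simp
qed

text \<open>Nonvanishing of \<open>lam\<close> keeps p from being a root of unity and makes the
  later denominators invertible; characteristic 0 allows the halving in
  \<open>moment_0\<close>.\<close>

locale T_fraction_params =
  fixes y q p :: "'a::field_char_0"
  assumes q_nonzero: "q \<noteq> 0" and y_nonzero: "y \<noteq> 0"
    and lam_nonzero: "\<And>n. n \<ge> 1 \<Longrightarrow> lam y q n \<noteq> 0"
    and p_eq: "p = q\<^sup>2"
begin

lemma p_nonzero: "p \<noteq> 0"
  using q_nonzero by (simp add: p_eq)

lemma lam_even: "lam y q (2 * k) = (p ^ k - 1)\<^sup>2"
  by (simp add: lam_def p_eq power_mult power2_commute)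

lemma lam_odd: "lam y q (Suc (2 * k)) = (1 + p ^ k * (q * y)) * (1 + p ^ k * (q / y))"
  by (simp add: lam_def p_eq power_mult) (simp add: divide_inverse mult_ac)

section \<open>Moments of the functional M\<close>

definition odd_lam_prod :: "nat \<Rightarrow> 'a" where
  "odd_lam_prod k = (\<Prod>i<k. lam y q (Suc (2 * i)))"

lemma odd_lam_prod_nonzero: "odd_lam_prod k \<noteq> 0"
  by (simp add: odd_lam_prod_def lam_nonzero)

lemma odd_lam_prod_Suc: "odd_lam_prod (Suc k) = odd_lam_prod k * lam y q (Suc (2 * k))"
  by (simp add: odd_lam_prod_def)

text \<open>
  \<open>moment n k\<close> is \<open>M (w\<^sup>k \<Prod>i<n. (1 + p\<^sup>i w) (1 + p\<^sup>i / w))\<close> for the functional \<open>M\<close> with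
  \<open>M (w\<^sup>k) = bil_coeff y q k\<close>.
\<close>

abbreviation moment :: "nat \<Rightarrow> int \<Rightarrow> 'a" where
  "moment n \<equiv> shift_prod p 0 0 n (bil_coeff y q)"

lemma moment_antisym: "moment n (- 1) = - moment n 0"
  using shift_prod_antisym[of "bil_coeff y q" p 0 n 0, OF bil_coeff_antisym] by simp

text \<open>Apply the operator with exponents 0 and 1 to \<open>bil_coeff_diff\<close> at index 0.
  Antisymmetry makes the left side twice the moment; each product on the right is
  \<open>odd_lam_prod n\<close>.\<close>

lemma moment_0: "moment n 0 = odd_lam_prod n"
proof -
  let ?f = "bil_coeff y q"
  have nz: "q * y \<noteq> 0" "q / y \<noteq> 0"
    using q_nonzero y_nonzero by simp_all
  have "(\<lambda>k. ?f k + (- 1) * (p powi k * ?f (k - 1))) = (\<lambda>k. (q * y) powi k + 1 * (q / y) powi k)"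
    using bil_coeff_diff[OF q_nonzero y_nonzero] by (simp add: p_eq)
  then have "shift_prod p 0 1 n (\<lambda>k. ?f k + (- 1) * (p powi k * ?f (k - 1))) 0 =
      shift_prod p 0 1 n (\<lambda>k. (q * y) powi k + 1 * (q / y) powi k) 0"
    by (simp only:)
  then have "shift_prod p 0 1 n ?f 0 - shift_prod p 1 0 n ?f (- 1) =
      (\<Prod>i<n. (1 + p ^ (0 + i) * (q * y)) * (1 + p ^ (1 + i) / (q * y))) +
      (\<Prod>i<n. (1 + p ^ (0 + i) * (q / y)) * (1 + p ^ (1 + i) / (q / y)))"
    by (simp only: shift_prod_linear shift_prod_twist[OF p_nonzero] shift_prod_powi[OF nz(1)]
        shift_prod_powi[OF nz(2)]) simp
  \<comment> \<open>Since p / (q y) = q / y, the two factors are those of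
    \<open>lam_odd\<close>.\<close>
  also have "(\<lambda>i. (1 + p ^ (0 + i) * (q * y)) * (1 + p ^ (1 + i) / (q * y))) =
      (\<lambda>i. lam y q (Suc (2 * i)))"
    using q_nonzero y_nonzero by (simp add: lam_odd fun_eq_iff p_eq power2_eq_square)
  also have "(\<lambda>i. (1 + p ^ (0 + i) * (q / y)) * (1 + p ^ (1 + i) / (q / y))) =
      (\<lambda>i. lam y q (Suc (2 * i)))"
    using q_nonzero y_nonzero by (simp add: lam_odd fun_eq_iff p_eq power2_eq_square)
  finally have "moment n 0 - moment n (- 1) = 2 * odd_lam_prod n"
    using shift_prod_diff[of p n ?f 0] by (simp add: odd_lam_prod_def)
  then show ?thesis
    by (simp add: moment_antisym)
qed

section \<open>Generating functions of the moments and the kernels\<close>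

definition moment_gf :: "nat \<Rightarrow> 'a fps" where
  "moment_gf n = Abs_fps (\<lambda>k. moment n (int k))"

text \<open>This is z (1 + p^n E)(1 + p^n / E) with E read as 1/z, its action on generating
  functions.\<close>

definition ker_den :: "nat \<Rightarrow> 'a fps" where
  "ker_den n = (1 + fps_const (p ^ n) * fps_X) * (fps_const (p ^ n) + fps_X)"

lemma ker_den_expand:
  "ker_den n = fps_const (p ^ n) * (1 + fps_X)\<^sup>2 + fps_const (lam y q (2 * n)) * fps_X"
proof -
  have *: "fps_const (lam y q (2 * n)) = (fps_const (p ^ n) - 1)\<^sup>2"
    by (simp add: lam_even power2_eq_square flip: fps_const_1_eq_1)
  show ?thesis
    unfolding ker_den_def * by (simp only: power2_eq_square) algebra
qed

lemma ker_den_inverse: "ker_den n * inverse (ker_den n) = 1"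
  by (rule inverse_mult_eq_1') (simp add: ker_den_def p_nonzero)

text \<open>The correction is the boundary term of a one-sided series: \<open>moment n 0\<close> is
  lost under E, and \<open>moment n (- 1)\<close>, its negative, enters under 1/E.\<close>

lemma moment_gf_Suc:
  "fps_X * moment_gf (Suc n) =
   ker_den n * moment_gf n - fps_const (p ^ n * odd_lam_prod n) * (1 + fps_X)"
proof (rule fps_ext)
  fix j
  let ?F = "moment_gf n" and ?c = "p ^ n"
  have "ker_den n = fps_const ?c + fps_const (1 + ?c * ?c) * fps_X + fps_const ?c * (fps_X * fps_X)"
    by (simp add: ker_den_def algebra_simps flip: fps_const_mult fps_const_add)
  then have den: "ker_den n * ?F = fps_const ?c * ?F + fps_const (1 + ?c * ?c) * (fps_X * ?F)
      + fps_const ?c * (fps_X * (fps_X * ?F))"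
    by (simp only: distrib_right mult.assoc)
  have step: "moment (Suc n) k = moment n k + ?c * moment n (k - 1)
      + ?c * (moment n (k + 1) + ?c * moment n k)" for k
    by (simp add: fwd_def bwd_def)
  consider "j = 0" | "j = 1" | i where "j = Suc (Suc i)"
    by (metis One_nat_def nat.exhaust)
  then show "(fps_X * moment_gf (Suc n)) $ j =
      (ker_den n * ?F - fps_const (?c * odd_lam_prod n) * (1 + fps_X)) $ j"
  proof cases
    case 1
    then show ?thesis
      by (simp add: den) (simp add: moment_gf_def moment_0)
  next
    case 2
    then show ?thesis
      unfolding den
      by (simp del: shift_prod.simps add: step moment_antisym moment_0 moment_gf_def algebra_simps)
  next
    case 3
    then show ?thesis
      unfolding den by (simp del: shift_prod.simps add: step moment_gf_def algebra_simps)
  qed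
qed

text \<open>The factor in front of \<open>moment_gf n\<close> after n uses of
  \<open>moment_gf_Suc\<close>.\<close>

primrec ker_rem :: "nat \<Rightarrow> 'a fps" where
  "ker_rem 0 = 1"
| "ker_rem (Suc n) = fps_X * ker_rem n * inverse (ker_den n)"

definition ker :: "nat \<Rightarrow> 'a fps" where
  "ker k = fps_const (p ^ k) * (1 + fps_X) * ker_rem k * inverse (ker_den k)"

lemma ker_den_ker_0: "ker_den 0 * ker 0 = 1 + fps_X"
  using ker_den_inverse[of 0] by (simp add: ker_def algebra_simps)

lemma ker_0: "(1 + fps_X) * ker 0 = 1"
proof -
  have "(1 + fps_X) * ((1 + fps_X) * ker 0) = (1 + fps_X) * 1"
    using ker_den_ker_0 by (simp add: ker_den_def algebra_simps)
  moreover have "(1 + fps_X :: 'a fps) \<noteq> 0"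
    by (simp add: fps_eq_iff exI[of _ 0])
  ultimately show ?thesis
    by (metis mult_left_cancel)
qed

lemma ker_den_ker_Suc: "ker_den (Suc k) * ker (Suc k) = fps_const p * fps_X * ker k"
proof -
  have "ker_den (Suc k) * ker (Suc k) = fps_const (p ^ Suc k) * (1 + fps_X) * ker_rem (Suc k)
      * (ker_den (Suc k) * inverse (ker_den (Suc k)))"
    by (simp only: ker_def mult_ac)
  then show ?thesis
    by (simp only: ker_den_inverse) (simp add: ker_def mult_ac flip: fps_const_mult)
qed

lemma fps_X_power_dvd_ker_rem: "fps_X ^ k dvd ker_rem k"
proof (induction k)
  case (Suc k)
  then show ?case
    by (simp add: mult_dvd_mono mult.assoc)
qed simp

lemma fps_X_power_dvd_ker: "fps_X ^ k dvd ker k"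
  using fps_X_power_dvd_ker_rem[of k] by (simp add: ker_def)

lemma ker_nth_less: "j < k \<Longrightarrow> ker k $ j = 0"
  using fps_X_power_dvd_ker[of k] by (auto simp: fps_X_power_mult_nth elim!: dvdE)

text \<open>
  Since \<open>ker k\<close> is divisible by \<open>z\<^sup>k\<close>, truncating the inner sum at \<open>j\<close> loses nothing:
  \<open>ker_series A\<close> is the \<open>z\<close>-adic sum \<open>\<Sum>k. A k * ker k\<close>.
\<close>

definition ker_series :: "(nat \<Rightarrow> 'a) \<Rightarrow> 'a fps" where
  "ker_series A = Abs_fps (\<lambda>j. \<Sum>k\<le>j. A k * ker k $ j)"

lemma ker_series_approx: "fps_X ^ Suc N dvd ker_series A - (\<Sum>k\<le>N. fps_const (A k) * ker k)"
proof (rule fps_X_power_dvdI)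
  fix j assume "j < Suc N"
  then have "(\<Sum>k\<le>N. A k * ker k $ j) = (\<Sum>k\<le>j. A k * ker k $ j)"
    by (intro sum.mono_neutral_right) (auto simp: ker_nth_less)
  then show "(ker_series A - (\<Sum>k\<le>N. fps_const (A k) * ker k)) $ j = 0"
    by (simp add: ker_series_def fps_sum_nth)
qed

lemma ker_series_diff: "ker_series (\<lambda>k. A k - c * B k) = ker_series A - fps_const c * ker_series B"
  by (rule fps_ext) (simp add: ker_series_def sum_subtractf sum_distrib_left algebra_simps)

lemma fps_X_power_dvd_ker_series:
  assumes "\<And>k. k < n \<Longrightarrow> A k = 0"
  shows "fps_X ^ n dvd ker_series A"
  by (rule fps_X_power_dvdI) (simp add: ker_series_def assms)

text \<open>Each use of \<open>moment_gf_Suc\<close> splits off one multiple of a kernel; the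
  remainder after n uses is divisible by z^n.\<close>

lemma moment_gf_0_eq_ker_series: "moment_gf 0 = ker_series odd_lam_prod"
proof (rule fps_eqI_dvd)
  fix N
  have telescope: "moment_gf 0 = (\<Sum>k<n. fps_const (odd_lam_prod k) * ker k) + ker_rem n * moment_gf n"
    for n
  proof (induction n)
    case (Suc n)
    have "ker_rem n * moment_gf n = ker_rem n * inverse (ker_den n) * (ker_den n * moment_gf n)"
      using ker_den_inverse[of n] by (simp add: algebra_simps)
    also have "ker_den n * moment_gf n =
        fps_X * moment_gf (Suc n) + fps_const (p ^ n * odd_lam_prod n) * (1 + fps_X)"
      by (simp add: moment_gf_Suc)
    also have "ker_rem n * inverse (ker_den n) * \<dots> =
        ker_rem (Suc n) * moment_gf (Suc n) + fps_const (odd_lam_prod n) * ker n"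
      by (simp add: ker_def algebra_simps flip: fps_const_mult)
    finally show ?case
      by (subst Suc) simp
  qed simp
  have "fps_X ^ Suc N dvd ker_rem (Suc N) * moment_gf (Suc N)"
    by (rule dvd_mult2[OF fps_X_power_dvd_ker_rem])
  then have "fps_X ^ Suc N dvd moment_gf 0 - (\<Sum>k\<le>N. fps_const (odd_lam_prod k) * ker k)"
    by (subst telescope[of "Suc N"]) (simp add: lessThan_Suc_atMost del: ker_rem.simps sum.lessThan_Suc)
  from dvd_diff[OF this ker_series_approx[of N odd_lam_prod]]
  show "fps_X ^ Suc N dvd moment_gf 0 - ker_series odd_lam_prod"
    by simp
qed

text \<open>By \<open>ker_den_expand\<close> and \<open>ker_den_ker_Suc\<close>, (1 + z)^2
  \<open>ker (Suc k)\<close> is z times a combination of \<open>ker k\<close> and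
  \<open>ker (Suc k)\<close>, so multiplication by (1 + z)^2 / z acts on coefficients.
  \<open>ker 0\<close> has no predecessor, hence \<open>B 0 = 0\<close>.\<close>

lemma ker_series_mult:
  assumes "B 0 = 0" and C: "\<And>k. p ^ k * C k = B (Suc k) - lam y q (2 * k) * B k"
  shows "(1 + fps_X)\<^sup>2 * ker_series B = fps_X * ker_series C"
proof (rule fps_eqI_dvd)
  fix N
  let ?S = "\<lambda>A. \<Sum>k\<le>N. fps_const (A k) * ker k"
  have C': "C k = (B (Suc k) - lam y q (2 * k) * B k) / p ^ k" for k
    using C[of k] p_nonzero by (simp add: field_simps)
  have ker_Suc: "(1 + fps_X)\<^sup>2 * ker (Suc k) = fps_X * (fps_const (1 / p ^ k) * ker k
      - fps_const (lam y q (2 * Suc k) / p ^ Suc k) * ker (Suc k))" for k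
  proof -
    have "fps_const (p ^ Suc k) * ((1 + fps_X)\<^sup>2 * ker (Suc k)) =
        fps_X * (fps_const p * ker k - fps_const (lam y q (2 * Suc k)) * ker (Suc k))"
      using ker_den_ker_Suc[of k] unfolding ker_den_expand by (simp only: algebra_simps)
    then have "fps_const (1 / p ^ Suc k) * (fps_const (p ^ Suc k) * ((1 + fps_X)\<^sup>2 * ker (Suc k))) =
        fps_const (1 / p ^ Suc k) *
        (fps_X * (fps_const p * ker k - fps_const (lam y q (2 * Suc k)) * ker (Suc k)))"
      by (simp only:)
    moreover have "fps_const (1 / p ^ Suc k) * (fps_const (p ^ Suc k) * H) = H" for H
      using p_nonzero by (simp flip: mult.assoc)
    moreover have "fps_const (1 / p ^ k) = fps_const (1 / p ^ Suc k) * fps_const p"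
      "fps_const (lam y q (2 * Suc k) / p ^ Suc k) =
        fps_const (1 / p ^ Suc k) * fps_const (lam y q (2 * Suc k))"
      using p_nonzero by simp_all
    ultimately show ?thesis
      by (simp only: right_diff_distrib mult.assoc mult.left_commute[of "fps_const (1 / p ^ Suc k)" fps_X])
  qed
  \<comment> \<open>Cutting at n leaves one boundary term, owed to the missing summand of index n +
    1; it is divisible by z^(n+1).\<close>
  have "(1 + fps_X)\<^sup>2 * (\<Sum>k\<le>n. fps_const (B k) * ker k) =
      fps_X * ((\<Sum>k\<le>n. fps_const (C k) * ker k) - fps_const (B (Suc n) / p ^ n) * ker n)" for n
  proof (induction n)
    case 0
    then show ?case
      using C[of 0] assms(1) by simp
  next
    case (Suc n)
    have "(1 + fps_X)\<^sup>2 * (\<Sum>k\<le>Suc n. fps_const (B k) * ker k) =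
        fps_X * ((\<Sum>k\<le>n. fps_const (C k) * ker k) - fps_const (B (Suc n) / p ^ n) * ker n)
        + fps_const (B (Suc n)) * ((1 + fps_X)\<^sup>2 * ker (Suc n))"
      by (simp add: distrib_left Suc mult_ac)
    also have "\<dots> = fps_X * ((\<Sum>k\<le>n. fps_const (C k) * ker k)
        - fps_const (lam y q (2 * Suc n) * B (Suc n) / p ^ Suc n) * ker (Suc n))"
    proof -
      have "fps_const (B (Suc n) / p ^ n) = fps_const (B (Suc n)) * fps_const (1 / p ^ n)"
        "fps_const (lam y q (2 * Suc n) * B (Suc n) / p ^ Suc n) =
          fps_const (B (Suc n)) * fps_const (lam y q (2 * Suc n) / p ^ Suc n)"
        by simp_all
      then show ?thesis
        unfolding ker_Suc by (simp only: algebra_simps)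
    qed
    also have "fps_const (lam y q (2 * Suc n) * B (Suc n) / p ^ Suc n) =
        fps_const (B (Suc (Suc n)) / p ^ Suc n) - fps_const (C (Suc n))"
      by (simp only: C' fps_const_sub) (simp add: diff_divide_distrib)
    finally show ?case
      by (simp only: sum.atMost_Suc algebra_simps)
  qed
  then have finite_id: "(1 + fps_X)\<^sup>2 * ?S B =
      fps_X * ?S C - fps_const (B (Suc N) / p ^ N) * (fps_X * ker N)"
    by (simp add: algebra_simps)
  have ker_N: "fps_X ^ Suc N dvd fps_X * ker N"
    using fps_X_power_dvd_ker[of N] by simp
  have "fps_X ^ Suc N dvd (1 + fps_X)\<^sup>2 * (ker_series B - ?S B) - fps_X * (ker_series C - ?S C)
      - fps_const (B (Suc N) / p ^ N) * (fps_X * ker N)"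
    by (rule dvd_diff[OF dvd_diff[OF dvd_mult dvd_mult] dvd_mult, OF ker_series_approx
          ker_series_approx ker_N])
  also have "\<dots> = (1 + fps_X)\<^sup>2 * ker_series B - fps_X * ker_series C"
    using finite_id by (simp add: algebra_simps)
  finally show "fps_X ^ Suc N dvd (1 + fps_X)\<^sup>2 * ker_series B - fps_X * ker_series C" .
qed

section \<open>Solving the three-term recurrence\<close>

text \<open>Equals \<open>odd_lam_prod k / odd_lam_prod n\<close> times p^(n(n-1)/2) times the
  Gaussian binomial of k over n in base p.\<close>

definition odd_coeff :: "nat \<Rightarrow> nat \<Rightarrow> 'a" where
  "odd_coeff n k = odd_lam_prod k * (\<Prod>i<n. p ^ k - p ^ i) /
     (odd_lam_prod n * (\<Prod>i<n. p ^ Suc i - 1))"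

text \<open>The clause for 0 selects \<open>ker 0\<close>, the inverse of 1 + z. For k > 0 the other
  clause is, up to a ratio of \<open>odd_lam_prod\<close> values and a power of p, the Gaussian
  binomial of k - 1 over n.\<close>

fun even_coeff :: "nat \<Rightarrow> nat \<Rightarrow> 'a" where
  "even_coeff 0 k = (if k = 0 then 1 else 0)"
| "even_coeff (Suc n) k = (if k = 0 then 0 else odd_lam_prod k * (\<Prod>i<n. p ^ k - p ^ Suc i) /
     (odd_lam_prod (Suc n) * (\<Prod>i<n. p ^ Suc i - 1)))"

lemma p_power_neq_1: "p ^ Suc i - 1 \<noteq> 0"
  using lam_nonzero[of "2 * Suc i"] by (simp only: lam_even) auto

lemma odd_coeff_less: "k < n \<Longrightarrow> odd_coeff n k = 0"
  by (auto simp: odd_coeff_def prod_zero_iff)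

lemma even_coeff_less: "k < n \<Longrightarrow> even_coeff n k = 0"
proof (cases n)
  case (Suc m)
  assume "k < n"
  then have "\<exists>i<m. p ^ k - p ^ Suc i = 0" if "k \<noteq> 0"
    using Suc that by (intro exI[of _ "k - 1"]) simp
  then show ?thesis
    using Suc by (auto simp: prod_zero_iff simp del: power_Suc)
qed simp

lemma odd_coeff_0: "odd_coeff 0 k = odd_lam_prod k"
  by (simp add: odd_coeff_def odd_lam_prod_def)

text \<open>For n > 0 and k > 0 this is the Pascal rule for Gaussian binomials.\<close>

lemma even_coeff_rec:
  "even_coeff n k = odd_coeff n k - lam y q (Suc (2 * n)) * even_coeff (Suc n) k"
proof (cases n)
  case 0
  then show ?thesis
    using lam_nonzero[of 1] by (auto simp: odd_coeff_def odd_lam_prod_def)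
next
  case (Suc m)
  show ?thesis
  proof (cases "k = 0")
    case True
    then show ?thesis
      using Suc by (simp add: odd_coeff_less)
  next
    case False
    define Z L P where "Z = (\<Prod>i<m. p ^ k - p ^ Suc i)" and "L = odd_lam_prod n"
      and "P = (\<Prod>i<m. p ^ Suc i - 1)"
    have nz: "L \<noteq> 0" "P \<noteq> 0" "p ^ n - 1 \<noteq> 0" "lam y q (Suc (2 * n)) \<noteq> 0"
      using odd_lam_prod_nonzero[of n] p_power_neq_1 p_power_neq_1[of m] lam_nonzero[of "Suc (2 * n)"]
      by (auto simp: L_def P_def Suc simp del: power_Suc)
    have 1: "even_coeff n k = odd_lam_prod k * Z / (L * P)"
      using False by (simp only: Suc even_coeff.simps Z_def L_def P_def if_False)
    have 2: "odd_coeff n k = odd_lam_prod k * ((p ^ k - 1) * Z) / (L * (P * (p ^ n - 1)))"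
      unfolding odd_coeff_def L_def P_def Z_def Suc
      by (simp only: prod.lessThan_Suc_shift[of "\<lambda>i. p ^ k - p ^ i"] power_0
          prod.lessThan_Suc[of "\<lambda>i. p ^ Suc i - 1"])
    have 3: "even_coeff (Suc n) k = odd_lam_prod k * (Z * (p ^ k - p ^ n)) /
        (L * lam y q (Suc (2 * n)) * (P * (p ^ n - 1)))"
      using False
      by (simp only: Suc even_coeff.simps Z_def L_def P_def if_False odd_lam_prod_Suc prod.lessThan_Suc)
    show ?thesis
      unfolding 1 2 3 using nz by (simp add: divide_simps) (simp add: algebra_simps)
  qed
qed

text \<open>Supplies the coefficient condition of \<open>ker_series_mult\<close>. Without the common
  factors it is the polynomial identity \<open>key\<close>, which rests on (q y)(q / y) = p.\<close>

lemma odd_coeff_rec: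
  "p ^ k * (odd_coeff n k + lam y q (2 * Suc n) * odd_coeff (Suc n) k) =
   even_coeff (Suc n) (Suc k) - lam y q (2 * k) * even_coeff (Suc n) k"
proof -
  define Z L P l r where "Z = (\<Prod>i<n. p ^ k - p ^ i)" and "L = odd_lam_prod n"
    and "P = (\<Prod>i<n. p ^ Suc i - 1)" and "l = lam y q (Suc (2 * n))" and "r = p * p ^ n - 1"
  have nz: "L \<noteq> 0" "P \<noteq> 0" "r \<noteq> 0" "l \<noteq> 0"
    using odd_lam_prod_nonzero[of n] p_power_neq_1 p_power_neq_1[of n] lam_nonzero[of "Suc (2 * n)"]
    by (auto simp: L_def P_def r_def l_def)
  have 1: "odd_coeff n k = odd_lam_prod k * Z / (L * P)"
    by (simp only: odd_coeff_def Z_def L_def P_def)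
  have 2: "odd_coeff (Suc n) k = odd_lam_prod k * (Z * (p ^ k - p ^ n)) / (L * l * (P * r))"
    by (simp only: odd_coeff_def Z_def L_def P_def l_def r_def odd_lam_prod_Suc prod.lessThan_Suc
        power_Suc)
  have "(\<Prod>i<n. p ^ Suc k - p ^ Suc i) = p ^ n * Z"
    unfolding Z_def by (simp add: prod.distrib flip: right_diff_distrib)
  then have 3: "even_coeff (Suc n) (Suc k) =
      odd_lam_prod k * lam y q (Suc (2 * k)) * (p ^ n * Z) / (L * l * P)"
    by (simp only: even_coeff.simps odd_lam_prod_Suc L_def P_def l_def nat.simps if_False)
  have "(p ^ k - 1) * (\<Prod>i<n. p ^ k - p ^ Suc i) = Z * (p ^ k - p ^ n)"
    unfolding Z_def using prod.lessThan_Suc_shift[of "\<lambda>i. p ^ k - p ^ i" n]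
    by (simp only: prod.lessThan_Suc power_0)
  then have 4: "(p ^ k - 1) * even_coeff (Suc n) k =
      odd_lam_prod k * (Z * (p ^ k - p ^ n)) / (L * l * P)"
    by (cases "k = 0") (auto simp: odd_lam_prod_Suc L_def P_def l_def mult.left_commute)
  have 5: "lam y q (2 * k) * even_coeff (Suc n) k =
      (p ^ k - 1) * (odd_lam_prod k * (Z * (p ^ k - p ^ n)) / (L * l * P))"
    by (simp only: lam_even power2_eq_square mult.assoc 4)
  have 6: "lam y q (2 * Suc n) = r\<^sup>2"
    by (simp only: lam_even r_def power_Suc)
  have key: "p ^ k * (l + r * (p ^ k - p ^ n)) =
      lam y q (Suc (2 * k)) * p ^ n - (p ^ k - 1) * (p ^ k - p ^ n)"
  proof -
    have "A * ((1 + B * u) * (1 + B * v) + (u * v * B - 1) * (A - B)) =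
        (1 + A * u) * (1 + A * v) * B - (A - 1) * (A - B)" for A B u v :: 'a
      by (simp add: algebra_simps)
    from this[of "p ^ k" "p ^ n" "q * y" "q / y"] show ?thesis
      unfolding l_def r_def lam_odd using y_nonzero by (simp add: p_eq power2_eq_square)
  qed
  have "p ^ k * (odd_coeff n k + lam y q (2 * Suc n) * odd_coeff (Suc n) k) =
      odd_lam_prod k * Z / (L * l * P) * (p ^ k * (l + r * (p ^ k - p ^ n)))"
    unfolding 1 2 6 using nz by (simp add: field_simps power2_eq_square)
  also have "\<dots> = even_coeff (Suc n) (Suc k) - lam y q (2 * k) * even_coeff (Suc n) k"
    unfolding key 3 5 using nz by (simp add: field_simps)
  finally show ?thesis .
qed

text \<open>
  Both kernel series start at \<open>z ^ (m div 2)\<close>, so the shifts are exact divisions.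
\<close>

definition T_solution :: "nat \<Rightarrow> 'a fps" where
  "T_solution m = (if even m then (1 + fps_X) * fps_shift (m div 2) (ker_series (even_coeff (m div 2)))
     else fps_shift (m div 2) (ker_series (odd_coeff (m div 2))))"

lemma T_solution_even:
  "fps_X ^ n * T_solution (2 * n) = (1 + fps_X) * ker_series (even_coeff n)"
  using fps_X_power_mult_shift[OF fps_X_power_dvd_ker_series[OF even_coeff_less]]
  by (simp add: T_solution_def mult.left_commute)

lemma T_solution_odd: "fps_X ^ n * T_solution (Suc (2 * n)) = ker_series (odd_coeff n)"
  using fps_X_power_mult_shift[OF fps_X_power_dvd_ker_series[OF odd_coeff_less]]
  by (simp add: T_solution_def)

lemma T_solution_0: "T_solution 0 = 1"
proof -
  have "ker_series (even_coeff 0) = ker 0"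
    by (rule fps_ext) (simp add: ker_series_def if_distrib[of "\<lambda>x. x * _"] cong: if_cong)
  then show ?thesis
    using T_solution_even[of 0] ker_0 by simp
qed

lemma T_solution_1: "T_solution 1 = Abs_fps (theta_coeff y q)"
proof -
  have "T_solution 1 = ker_series (odd_coeff 0)"
    using T_solution_odd[of 0] by simp
  also have "odd_coeff 0 = odd_lam_prod"
    by (simp add: fun_eq_iff odd_coeff_0)
  also have "ker_series odd_lam_prod = Abs_fps (theta_coeff y q)"
    by (simp add: moment_gf_def bil_coeff_def flip: moment_gf_0_eq_ker_series)
  finally show ?thesis .
qed

lemma T_solution_rec:
  "T_solution m = (1 + fps_X) * T_solution (Suc m)
     - fps_const (lam y q (Suc m)) * fps_X * T_solution (Suc (Suc m))"
proof -
  have cancel: "f = g" if "fps_X ^ n * f = fps_X ^ n * g" for n and f g :: "'a fps"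
    using that by simp
  define n where "n = m div 2"
  show ?thesis
  proof (cases "even m")
    case True
    then have m: "m = 2 * n" by (simp add: n_def)
    have "even_coeff n = (\<lambda>k. odd_coeff n k - lam y q (Suc (2 * n)) * even_coeff (Suc n) k)"
      by (rule ext) (rule even_coeff_rec)
    then have "ker_series (even_coeff n) = ker_series (odd_coeff n)
        - fps_const (lam y q (Suc (2 * n))) * ker_series (even_coeff (Suc n))"
      by (metis ker_series_diff)
    then have "(1 + fps_X) * ker_series (even_coeff n) = (1 + fps_X) * ker_series (odd_coeff n)
        - fps_const (lam y q (Suc (2 * n))) * ((1 + fps_X) * ker_series (even_coeff (Suc n)))"
      by (simp only: right_diff_distrib mult.left_commute)
    then show ?thesis
      unfolding m T_solution_even[symmetric] T_solution_odd[symmetric]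
      by - (rule cancel[of n], simp add: algebra_simps)
  next
    case False
    then have m: "m = Suc (2 * n)" by (simp add: n_def)
    \<comment> \<open>The double sign brings the sum into the shape of
      \<open>ker_series_diff\<close>; \<open>even_coeff (Suc n) 0 = 0\<close> is the initial
      condition.\<close>
    have "(1 + fps_X)\<^sup>2 * ker_series (even_coeff (Suc n)) =
        fps_X * ker_series (\<lambda>k. odd_coeff n k - (- lam y q (2 * Suc n)) * odd_coeff (Suc n) k)"
      using odd_coeff_rec[of _ n] by (intro ker_series_mult) simp_all
    then have "fps_X * ker_series (odd_coeff n) =
        (1 + fps_X) * ((1 + fps_X) * ker_series (even_coeff (Suc n)))
        - fps_const (lam y q (2 * Suc n)) * (fps_X * ker_series (odd_coeff (Suc n)))"
      unfolding ker_series_diff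
      by (simp add: power2_eq_square algebra_simps flip: fps_const_neg)
    then show ?thesis
      unfolding m T_solution_even[symmetric] T_solution_odd[symmetric]
      by - (rule cancel[of "Suc n"], simp add: algebra_simps)
  qed
qed

lemma T_fraction_has_value_lam: "T_fraction_has_value (lam y q) (Abs_fps (theta_coeff y q))"
  using T_fraction_has_valueI[of T_solution "lam y q", OF T_solution_0 T_solution_rec]
  by (simp only: T_solution_1)

end

section \<open>Nonvanishing at the indeterminates and conclusion\<close>

lemma q_ind_power: "q_ind ^ n = Fract [:[:0, 1:] ^ n:] 1"
  by (induction n) (simp_all add: q_ind_def One_fract_def one_pCons mult.commute)

lemma Fract_eq_0_iff: "Fract a 1 = 0 \<longleftrightarrow> a = 0" for a :: "'a::idom"
  by (simp add: Zero_fract_def eq_fract)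

lemma lam_ind_nonzero:
  assumes "n \<ge> 1"
  shows "lam y_ind q_ind n \<noteq> 0"
proof -
  have nz: "y_ind \<noteq> 0"
    by (simp add: y_ind_def Fract_eq_0_iff)
  have "1 + q_ind ^ n * y_ind = Fract [:1, [:0, 1:] ^ n:] 1"
    by (simp add: q_ind_power y_ind_def One_fract_def one_pCons)
  then have 1: "1 + q_ind ^ n * y_ind \<noteq> 0"
    by (simp add: Fract_eq_0_iff)
  \<comment> \<open>Multiplying 1 + q^n / y by y gives a polynomial in y.\<close>
  have "y_ind + q_ind ^ n = Fract [:[:0, 1:] ^ n, 1:] 1"
    by (simp add: q_ind_power y_ind_def)
  then have "y_ind + q_ind ^ n \<noteq> 0"
    by (simp add: Fract_eq_0_iff)
  then have 2: "1 + q_ind ^ n * inverse y_ind \<noteq> 0"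
    using nz by (simp add: field_simps)
  have "1 - q_ind ^ n = Fract [:1 - [:0, 1:] ^ n:] 1"
    by (simp add: q_ind_power One_fract_def one_pCons)
  \<comment> \<open>At q = 0 the polynomial 1 - q^n has the value 1, because n is positive.\<close>
  moreover have "poly (1 - [:0, 1:] ^ n :: int poly) 0 \<noteq> 0"
    using assms by (simp add: power_0_left)
  then have "1 - [:0, 1:] ^ n \<noteq> (0 :: int poly)"
    by (metis poly_0)
  ultimately have 3: "1 - q_ind ^ n \<noteq> 0"
    by (simp add: Fract_eq_0_iff)
  show ?thesis
    using 1 2 3 by (simp add: lam_def)
qed

theorem theorem7p1:
  shows "T_fraction_has_value (lam y_ind q_ind)
    (Abs_fps (\<lambda>k. \<Sum>j = - int k..int k.
       y_ind powi j * q_ind powi (int k * (int k + 1) - j\<^sup>2)))"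
proof -
  interpret T_fraction_params y_ind q_ind "q_ind\<^sup>2"
    by unfold_locales
      (simp_all only: lam_ind_nonzero, simp_all add: q_ind_def y_ind_def Fract_eq_0_iff)
  show ?thesis
    using T_fraction_has_value_lam by (simp add: theta_coeff_def[abs_def])
qed

end
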